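(* Let $R$ be a commutative semiring, $M$ an $R$-semimodule, and let $\mathrm{Dis}_M$ be any one of the distinguished classes of subsemimodules of $M$. If the zero subsemimodule $0$ belongs to $\mathrm{Dis}_M$, then the subsemimodule space $\mathrm{Dis}_M$ is connected.
   Context: A (commutative) semiring is $(R,+,0,\cdot,1)$ with $(R,+,0)$ and $(R,\cdot,1)$ commutative monoids, $0r=0=r0$ for all $r$, and $\cdot$ distributing over $+$. An $R$-semimodule $M$ is an additive commutative monoid with a scalar multiplication $R\times M\to M$ satisfying $(r+r')m=rm+r'm$, $r(m+m')=rm+rm'$, $(rr')m=r(r'm)$, $1m=m$, $r0=0=0m$. A subsemimodule of $M$ is a nonempty subset closed under addition and scalar multiplication; $\mathrm{Sub}_M$ is the set of all of them. Write $(N:M)=\{r\in R\mid rM\subseteq N\}$. Distinguished classes. A subsemimodule $N$ of $M$ is: subtractive if $x+y\in N$ and $x\in N$ imply $y\in N$; strong if $x+y\in N$ implies $x,y\in N$; proper if $N\ne M$; maximal if $N$ is proper and no other proper subsemimodule contains $N$; prime if $N$ is proper and $rm\in N$ ($r\in R$, $m\in M$) implies $m\in N$ or $r\in (N:M)$; primary if $N$ is proper and $rm\in N$ implies $m\in N$ or $r^n\in (N:M)$ for some $n\in\mathbb N$; weakly prime if $N$ is proper and $0\ne rm\in N$ implies $m\in N$ or $rM\subseteq N$; primal if $N$ is proper and $R\setminus \mathrm{Prm}(N)$ is an ideal of $R$, where $\mathrm{Prm}(N)$ is the set of $r\in R$ such that, for all $m\in M$, $rm\in N$ implies $m\in N$;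 semiprime if $N$ is an intersection of prime subsemimodules of $M$; extraordinary if $N$ is prime and for all semiprime subsemimodules $L,K$, $L\cap K\subseteq N$ implies $L\subseteq N$ or $K\subseteq N$; strongly irreducible if for all subsemimodules $L,K$, $L\cap K\subseteq N$ implies $L\subseteq N$ or $K\subseteq N$; irreducible (completely irreducible) if $N$ is not the intersection of two (of any set of) subsemimodules of $M$ in which $N$ is properly contained; cyclic (finitely generated) if $N$ is generated by one element (by a finite set of elements); minimal if $N\neq 0$ and $N$ contains no other nonzero subsemimodule; minimal prime if $N$ is both minimal and prime. $\mathrm{Dis}_M$ denotes the set of all subsemimodules of $M$ of any one of these types, with the convention $M\notin \mathrm{Dis}_M$. For $N\in\mathrm{Sub}_M$ put $\mathcal V(N)=\{L\in\mathrm{Dis}_M\mid N\subseteq L\}$. The topology on $\mathrm{Dis}_M$ is the one having $\{\mathcal V(N)\}_{N\in \mathrm{Sub}_M}$ as a closed subbasis (closed sets are arbitrary intersections of finite unions of sets $\mathcal V(N)$); $\mathrm{Dis}_M$ with this topology is called a subsemimodule space. *)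

theory Defs
  imports "HOL-Algebra.Module" "HOL-Analysis.Abstract_Topology"
begin

locale csemiring = semiring R + comm_monoid R for R (structure)

text \<open>
  As for \<open>module\<close> in HOL-Algebra, only the fields \<open>carrier\<close>, \<open>add\<close>, \<open>zero\<close> and
  \<open>smult\<close> of the record \<open>M\<close> are constrained.
\<close>

locale semimodule = R?: csemiring R + M?: abelian_monoid M for R (structure) and M (structure) +
  assumes smult_closed [simp, intro]:
      "\<lbrakk>r \<in> carrier R; m \<in> carrier M\<rbrakk> \<Longrightarrow> r \<odot>\<^bsub>M\<^esub> m \<in> carrier M"
    and smult_l_distr:
      "\<lbrakk>r \<in> carrier R; r' \<in> carrier R; m \<in> carrier M\<rbrakk> \<Longrightarrow>
        (r \<oplus>\<^bsub>R\<^esub> r') \<odot>\<^bsub>M\<^esub> m = r \<odot>\<^bsub>M\<^esub> m \<oplus>\<^bsub>M\<^esub> r' \<odot>\<^bsub>M\<^esub> m"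
    and smult_r_distr:
      "\<lbrakk>r \<in> carrier R; m \<in> carrier M; m' \<in> carrier M\<rbrakk> \<Longrightarrow>
        r \<odot>\<^bsub>M\<^esub> (m \<oplus>\<^bsub>M\<^esub> m') = r \<odot>\<^bsub>M\<^esub> m \<oplus>\<^bsub>M\<^esub> r \<odot>\<^bsub>M\<^esub> m'"
    and smult_assoc:
      "\<lbrakk>r \<in> carrier R; r' \<in> carrier R; m \<in> carrier M\<rbrakk> \<Longrightarrow>
        (r \<otimes>\<^bsub>R\<^esub> r') \<odot>\<^bsub>M\<^esub> m = r \<odot>\<^bsub>M\<^esub> (r' \<odot>\<^bsub>M\<^esub> m)"
    and smult_one [simp]: "m \<in> carrier M \<Longrightarrow> \<one>\<^bsub>R\<^esub> \<odot>\<^bsub>M\<^esub> m = m"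
    and smult_r_null [simp]: "r \<in> carrier R \<Longrightarrow> r \<odot>\<^bsub>M\<^esub> \<zero>\<^bsub>M\<^esub> = \<zero>\<^bsub>M\<^esub>"
    and smult_l_null [simp]: "m \<in> carrier M \<Longrightarrow> \<zero>\<^bsub>R\<^esub> \<odot>\<^bsub>M\<^esub> m = \<zero>\<^bsub>M\<^esub>"

definition subsemimodules ::
    "('r, 'a) ring_scheme \<Rightarrow> ('r, 'm, 'b) module_scheme \<Rightarrow> 'm set set" where
  "subsemimodules R M = {N. N \<subseteq> carrier M \<and> N \<noteq> {} \<and>
     (\<forall>x\<in>N. \<forall>y\<in>N. x \<oplus>\<^bsub>M\<^esub> y \<in> N) \<and> (\<forall>r\<in>carrier R. \<forall>x\<in>N. r \<odot>\<^bsub>M\<^esub> x \<in> N)}"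

definition semiring_ideal :: "('r, 'a) ring_scheme \<Rightarrow> 'r set \<Rightarrow> bool" where
  "semiring_ideal R I \<longleftrightarrow> I \<subseteq> carrier R \<and> I \<noteq> {} \<and>
     (\<forall>a\<in>I. \<forall>b\<in>I. a \<oplus>\<^bsub>R\<^esub> b \<in> I) \<and> (\<forall>r\<in>carrier R. \<forall>a\<in>I. r \<otimes>\<^bsub>R\<^esub> a \<in> I)"

text \<open>The residual \<open>(N : M)\<close>.\<close>

definition residual ::
    "('r, 'a) ring_scheme \<Rightarrow> ('r, 'm, 'b) module_scheme \<Rightarrow> 'm set \<Rightarrow> 'r set" where
  "residual R M N = {r \<in> carrier R. \<forall>m\<in>carrier M. r \<odot>\<^bsub>M\<^esub> m \<in> N}"

definition generated_subsemimodule ::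
    "('r, 'a) ring_scheme \<Rightarrow> ('r, 'm, 'b) module_scheme \<Rightarrow> 'm set \<Rightarrow> 'm set" where
  "generated_subsemimodule R M S = \<Inter>{N \<in> subsemimodules R M. S \<subseteq> N}"

definition subtractive_subsemimodule ::
    "('r, 'a) ring_scheme \<Rightarrow> ('r, 'm, 'b) module_scheme \<Rightarrow> 'm set \<Rightarrow> bool" where
  "subtractive_subsemimodule R M N \<longleftrightarrow> N \<in> subsemimodules R M \<and>
     (\<forall>x\<in>carrier M. \<forall>y\<in>carrier M. x \<oplus>\<^bsub>M\<^esub> y \<in> N \<and> x \<in> N \<longrightarrow> y \<in> N)"

definition strong_subsemimodule ::
    "('r, 'a) ring_scheme \<Rightarrow> ('r, 'm, 'b) module_scheme \<Rightarrow> 'm set \<Rightarrow> bool" where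
  "strong_subsemimodule R M N \<longleftrightarrow> N \<in> subsemimodules R M \<and>
     (\<forall>x\<in>carrier M. \<forall>y\<in>carrier M. x \<oplus>\<^bsub>M\<^esub> y \<in> N \<longrightarrow> x \<in> N \<and> y \<in> N)"

definition proper_subsemimodule ::
    "('r, 'a) ring_scheme \<Rightarrow> ('r, 'm, 'b) module_scheme \<Rightarrow> 'm set \<Rightarrow> bool" where
  "proper_subsemimodule R M N \<longleftrightarrow> N \<in> subsemimodules R M \<and> N \<noteq> carrier M"

definition maximal_subsemimodule ::
    "('r, 'a) ring_scheme \<Rightarrow> ('r, 'm, 'b) module_scheme \<Rightarrow> 'm set \<Rightarrow> bool" where
  "maximal_subsemimodule R M N \<longleftrightarrow> proper_subsemimodule R M N \<and>
     (\<forall>L. proper_subsemimodule R M L \<and> N \<subseteq> L \<longrightarrow> L = N)"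

definition prime_subsemimodule ::
    "('r, 'a) ring_scheme \<Rightarrow> ('r, 'm, 'b) module_scheme \<Rightarrow> 'm set \<Rightarrow> bool" where
  "prime_subsemimodule R M N \<longleftrightarrow> proper_subsemimodule R M N \<and>
     (\<forall>r\<in>carrier R. \<forall>m\<in>carrier M. r \<odot>\<^bsub>M\<^esub> m \<in> N \<longrightarrow> m \<in> N \<or> r \<in> residual R M N)"

definition primary_subsemimodule ::
    "('r, 'a) ring_scheme \<Rightarrow> ('r, 'm, 'b) module_scheme \<Rightarrow> 'm set \<Rightarrow> bool" where
  "primary_subsemimodule R M N \<longleftrightarrow> proper_subsemimodule R M N \<and>
     (\<forall>r\<in>carrier R. \<forall>m\<in>carrier M. r \<odot>\<^bsub>M\<^esub> m \<in> N \<longrightarrow>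
        m \<in> N \<or> (\<exists>n::nat. r [^]\<^bsub>R\<^esub> n \<in> residual R M N))"

definition weakly_prime_subsemimodule ::
    "('r, 'a) ring_scheme \<Rightarrow> ('r, 'm, 'b) module_scheme \<Rightarrow> 'm set \<Rightarrow> bool" where
  "weakly_prime_subsemimodule R M N \<longleftrightarrow> proper_subsemimodule R M N \<and>
     (\<forall>r\<in>carrier R. \<forall>m\<in>carrier M. r \<odot>\<^bsub>M\<^esub> m \<noteq> \<zero>\<^bsub>M\<^esub> \<and> r \<odot>\<^bsub>M\<^esub> m \<in> N \<longrightarrow>
        m \<in> N \<or> r \<in> residual R M N)"

text \<open>The elements \<open>Prm(N)\<close> of the semiring that are prime to \<open>N\<close>.\<close>

definition prime_to ::
    "('r, 'a) ring_scheme \<Rightarrow> ('r, 'm, 'b) module_scheme \<Rightarrow> 'm set \<Rightarrow> 'r set" where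
  "prime_to R M N = {r \<in> carrier R. \<forall>m\<in>carrier M. r \<odot>\<^bsub>M\<^esub> m \<in> N \<longrightarrow> m \<in> N}"

definition primal_subsemimodule ::
    "('r, 'a) ring_scheme \<Rightarrow> ('r, 'm, 'b) module_scheme \<Rightarrow> 'm set \<Rightarrow> bool" where
  "primal_subsemimodule R M N \<longleftrightarrow> proper_subsemimodule R M N \<and>
     semiring_ideal R (carrier R - prime_to R M N)"

text \<open>
  Intersections of families of subsemimodules are taken inside \<open>M\<close>, so the empty family has
  intersection \<open>M\<close>.
\<close>

definition semiprime_subsemimodule ::
    "('r, 'a) ring_scheme \<Rightarrow> ('r, 'm, 'b) module_scheme \<Rightarrow> 'm set \<Rightarrow> bool" where
  "semiprime_subsemimodule R M N \<longleftrightarrow>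
     (\<exists>\<F>. \<F> \<subseteq> {P. prime_subsemimodule R M P} \<and> N = carrier M \<inter> \<Inter>\<F>)"

definition extraordinary_subsemimodule ::
    "('r, 'a) ring_scheme \<Rightarrow> ('r, 'm, 'b) module_scheme \<Rightarrow> 'm set \<Rightarrow> bool" where
  "extraordinary_subsemimodule R M N \<longleftrightarrow> prime_subsemimodule R M N \<and>
     (\<forall>L K. semiprime_subsemimodule R M L \<and> semiprime_subsemimodule R M K \<and> L \<inter> K \<subseteq> N \<longrightarrow>
        L \<subseteq> N \<or> K \<subseteq> N)"

definition strongly_irreducible_subsemimodule ::
    "('r, 'a) ring_scheme \<Rightarrow> ('r, 'm, 'b) module_scheme \<Rightarrow> 'm set \<Rightarrow> bool" where
  "strongly_irreducible_subsemimodule R M N \<longleftrightarrow> N \<in> subsemimodules R M \<and>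
     (\<forall>L\<in>subsemimodules R M. \<forall>K\<in>subsemimodules R M. L \<inter> K \<subseteq> N \<longrightarrow> L \<subseteq> N \<or> K \<subseteq> N)"

definition irreducible_subsemimodule ::
    "('r, 'a) ring_scheme \<Rightarrow> ('r, 'm, 'b) module_scheme \<Rightarrow> 'm set \<Rightarrow> bool" where
  "irreducible_subsemimodule R M N \<longleftrightarrow> N \<in> subsemimodules R M \<and>
     \<not> (\<exists>L\<in>subsemimodules R M. \<exists>K\<in>subsemimodules R M. N \<subset> L \<and> N \<subset> K \<and> N = L \<inter> K)"

definition completely_irreducible_subsemimodule ::
    "('r, 'a) ring_scheme \<Rightarrow> ('r, 'm, 'b) module_scheme \<Rightarrow> 'm set \<Rightarrow> bool" where
  "completely_irreducible_subsemimodule R M N \<longleftrightarrow> N \<in> subsemimodules R M \<and>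
     \<not> (\<exists>\<F>. \<F> \<subseteq> {L \<in> subsemimodules R M. N \<subset> L} \<and> N = carrier M \<inter> \<Inter>\<F>)"

definition cyclic_subsemimodule ::
    "('r, 'a) ring_scheme \<Rightarrow> ('r, 'm, 'b) module_scheme \<Rightarrow> 'm set \<Rightarrow> bool" where
  "cyclic_subsemimodule R M N \<longleftrightarrow> N \<in> subsemimodules R M \<and>
     (\<exists>x\<in>carrier M. N = generated_subsemimodule R M {x})"

definition finitely_generated_subsemimodule ::
    "('r, 'a) ring_scheme \<Rightarrow> ('r, 'm, 'b) module_scheme \<Rightarrow> 'm set \<Rightarrow> bool" where
  "finitely_generated_subsemimodule R M N \<longleftrightarrow> N \<in> subsemimodules R M \<and>
     (\<exists>S. finite S \<and> S \<subseteq> carrier M \<and> N = generated_subsemimodule R M S)"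

definition minimal_subsemimodule ::
    "('r, 'a) ring_scheme \<Rightarrow> ('r, 'm, 'b) module_scheme \<Rightarrow> 'm set \<Rightarrow> bool" where
  "minimal_subsemimodule R M N \<longleftrightarrow> N \<in> subsemimodules R M \<and> N \<noteq> {\<zero>\<^bsub>M\<^esub>} \<and>
     (\<forall>L\<in>subsemimodules R M. L \<subseteq> N \<and> L \<noteq> {\<zero>\<^bsub>M\<^esub>} \<longrightarrow> L = N)"

text \<open>Minimal and prime at once; this is not minimality among the prime subsemimodules.\<close>

definition minimal_prime_subsemimodule ::
    "('r, 'a) ring_scheme \<Rightarrow> ('r, 'm, 'b) module_scheme \<Rightarrow> 'm set \<Rightarrow> bool" where
  "minimal_prime_subsemimodule R M N \<longleftrightarrow>
     minimal_subsemimodule R M N \<and> prime_subsemimodule R M N"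

text \<open>
  The possible values of \<open>Dis\<^sub>M\<close>: one set of subsemimodules for each type, always with \<open>M\<close>
  itself removed.
\<close>

definition distinguished_classes ::
    "('r, 'a) ring_scheme \<Rightarrow> ('r, 'm, 'b) module_scheme \<Rightarrow> 'm set set set" where
  "distinguished_classes R M = (\<lambda>P. {N. P N \<and> N \<noteq> carrier M}) `
     {subtractive_subsemimodule R M,
      strong_subsemimodule R M,
      proper_subsemimodule R M,
      maximal_subsemimodule R M,
      prime_subsemimodule R M,
      primary_subsemimodule R M,
      weakly_prime_subsemimodule R M,
      primal_subsemimodule R M,
      semiprime_subsemimodule R M,
      extraordinary_subsemimodule R M,
      strongly_irreducible_subsemimodule R M,
      irreducible_subsemimodule R M,
      completely_irreducible_subsemimodule R M,
      cyclic_subsemimodule R M,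
      finitely_generated_subsemimodule R M,
      minimal_subsemimodule R M,
      minimal_prime_subsemimodule R M}"

definition subsemimodules_above :: "'m set set \<Rightarrow> 'm set \<Rightarrow> 'm set set" where
  "subsemimodules_above Dis N = {L \<in> Dis. N \<subseteq> L}"

text \<open>
  The complements of the sets \<open>\<V>(N)\<close> form an open subbasis; the lemma
  \<open>closedin_subsemimodule_space\<close> below describes the closed sets.
\<close>

definition subsemimodule_space ::
    "('r, 'a) ring_scheme \<Rightarrow> ('r, 'm, 'b) module_scheme \<Rightarrow> 'm set set \<Rightarrow> 'm set topology" where
  "subsemimodule_space R M Dis = topology (arbitrary union_of (finite intersection_of
     (\<lambda>U. \<exists>N\<in>subsemimodules R M. U = Dis - subsemimodules_above Dis N) relative_to Dis))"

lemma topspace_subsemimodule_space [simp]: "topspace (subsemimodule_space R M Dis) = Dis"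
  by (simp add: subsemimodule_space_def)

lemma closedin_subsemimodule_space:
  "closedin (subsemimodule_space R M Dis) C \<longleftrightarrow>
     (arbitrary intersection_of (finite union_of
        (\<lambda>V. \<exists>N\<in>subsemimodules R M. V = subsemimodules_above Dis N)) relative_to Dis) C"
    (is "?closed C \<longleftrightarrow> (arbitrary intersection_of (finite union_of ?V) relative_to Dis) C")
proof
  let ?B = "\<lambda>U. \<exists>N\<in>subsemimodules R M. U = Dis - subsemimodules_above Dis N"
  have V_compl: "?V (Dis - U)" if "?B U" for U
    using that by (auto simp: subsemimodules_above_def Diff_Diff_Int Int_def)
  assume C: "?closed C"
  then have CD: "C \<subseteq> Dis"
    and "(arbitrary union_of (finite intersection_of ?B relative_to Dis)) (Dis - C)"
    by (simp_all add: closedin_def subsemimodule_space_def openin_subbase)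
  then obtain \<U> where \<U>: "\<U> \<subseteq> Collect (finite intersection_of ?B relative_to Dis)"
      "\<Union>\<U> = Dis - C"
    unfolding union_of_def by blast
  have fin: "(finite union_of ?V) (Dis - U)" if U: "U \<in> \<U>" for U
  proof -
    have "(finite intersection_of ?B relative_to Dis) U"
      using \<U>(1) U by blast
    then obtain \<T> where \<T>: "finite \<T>" "\<T> \<subseteq> Collect ?B" "U = Dis \<inter> \<Inter>\<T>"
      unfolding relative_to_def intersection_of_def by blast
    have "finite ((\<lambda>T. Dis - T) ` \<T>)"
      using \<T>(1) by simp
    moreover have "(\<lambda>T. Dis - T) ` \<T> \<subseteq> Collect ?V"
    proof
      fix W
      assume "W \<in> (\<lambda>T. Dis - T) ` \<T>"
      then obtain T where "T \<in> \<T>" and W: "W = Dis - T"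
        by (rule imageE)
      then have "?B T"
        using \<T>(2) by auto
      then show "W \<in> Collect ?V"
        using V_compl W by simp
    qed
    moreover have "\<Union>((\<lambda>T. Dis - T) ` \<T>) = Dis - U"
      unfolding \<T>(3) by blast
    ultimately show ?thesis
      unfolding union_of_def by (intro exI[of _ "(\<lambda>T. Dis - T) ` \<T>"] conjI)
  qed
  have "(\<lambda>U. Dis - U) ` \<U> \<subseteq> Collect (finite union_of ?V)"
    using fin by (simp add: image_subset_iff)
  then have "(arbitrary intersection_of (finite union_of ?V)) (\<Inter>U\<in>\<U>. Dis - U)"
    unfolding intersection_of_def arbitrary_def
    by (intro exI[of _ "(\<lambda>U. Dis - U) ` \<U>"] conjI TrueI refl)
  moreover have "Dis \<inter> (\<Inter>U\<in>\<U>. Dis - U) = C"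
    using \<U>(2) CD by blast
  ultimately show "(arbitrary intersection_of (finite union_of ?V) relative_to Dis) C"
    unfolding relative_to_def by (intro exI[of _ "\<Inter>U\<in>\<U>. Dis - U"] conjI)
next
  assume "(arbitrary intersection_of (finite union_of ?V) relative_to Dis) C"
  then obtain \<C> where \<C>: "\<C> \<subseteq> Collect (finite union_of ?V)" "C = Dis \<inter> \<Inter>\<C>"
    unfolding relative_to_def intersection_of_def by blast
  have closed_V: "?closed V" if "?V V" for V
  proof -
    let ?P = "\<lambda>U. \<exists>N\<in>subsemimodules R M. U = Dis - subsemimodules_above Dis N"
    have "?P (Dis - V)"
      using that by blast
    then have "(finite intersection_of ?P relative_to Dis) (Dis \<inter> (Dis - V))"
      by (intro relative_to_inc finite_intersection_of_inc)
    then have "openin (subsemimodule_space R M Dis) (Dis \<inter> (Dis - V))"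
      unfolding subsemimodule_space_def openin_subbase by (rule arbitrary_union_of_inc)
    moreover have "Dis \<inter> (Dis - V) = Dis - V"
      by blast
    moreover have "V \<subseteq> Dis"
      using that by (auto simp: subsemimodules_above_def)
    ultimately show ?thesis
      by (simp add: closedin_def)
  qed
  have "?closed D" if "D \<in> \<C>" for D
  proof -
    have "(finite union_of ?V) D"
      using \<C>(1) that by blast
    then obtain \<T> where \<T>: "finite \<T>" "\<T> \<subseteq> Collect ?V" "\<Union>\<T> = D"
      unfolding union_of_def by blast
    have "?closed T" if "T \<in> \<T>" for T
      using \<T>(2) that closed_V[of T] by auto
    then show ?thesis
      using \<T>(1,3) closedin_Union[of \<T> "subsemimodule_space R M Dis"] by simp
  qed
  moreover have "?closed Dis"
    using closedin_topspace[of "subsemimodule_space R M Dis"] by simp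
  ultimately have "?closed (\<Inter>(insert Dis \<C>))"
    by (intro closedin_Inter) auto
  then show "?closed C"
    using \<C>(2) by simp
qed

end

theory Submission
  imports Defs
begin

text \<open>
  The zero subsemimodule, once it is a point of the space, is a generic point. The reason is that
  it lies in \<open>\<V>(N)\<close> only if \<open>N = 0\<close>, and then \<open>\<V>(N)\<close> is the whole space, because every
  subsemimodule contains \<open>0\<close>. Hence a finite union of sets \<open>\<V>(N)\<close> that contains the point \<open>0\<close> is
  the whole space, and so is an intersection of such unions: the closure of the point \<open>0\<close> is the
  whole space. A space that is the closure of one point is connected, since the closure of a
  connected set is connected.

  The argument serves every distinguished class at once, because all members of such a class are
  subsemimodules.
\<close>

lemma (in semimodule) zero_mem_subsemimodule:
  assumes "N \<in> subsemimodules R M"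
  shows "\<zero>\<^bsub>M\<^esub> \<in> N"
proof -
  from assms obtain x where "x \<in> N" "x \<in> carrier M"
    by (auto simp: subsemimodules_def)
  then have "\<zero>\<^bsub>R\<^esub> \<odot>\<^bsub>M\<^esub> x \<in> N"
    using assms R.zero_closed unfolding subsemimodules_def by blast
  then show ?thesis
    using \<open>x \<in> carrier M\<close> by simp
qed

lemma (in semimodule) carrier_Int_Inter_subsemimodules:
  assumes "\<F> \<subseteq> subsemimodules R M"
  shows "carrier M \<inter> \<Inter>\<F> \<in> subsemimodules R M"
proof -
  have "\<zero>\<^bsub>M\<^esub> \<in> carrier M \<inter> \<Inter>\<F>"
    using assms zero_mem_subsemimodule by auto
  then have "carrier M \<inter> \<Inter>\<F> \<noteq> {}"
    by blast
  moreover have "x \<oplus>\<^bsub>M\<^esub> y \<in> N" if "N \<in> \<F>" "x \<in> N" "y \<in> N" for N x y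
    using assms that by (auto simp: subsemimodules_def)
  moreover have "r \<odot>\<^bsub>M\<^esub> x \<in> N" if "N \<in> \<F>" "r \<in> carrier R" "x \<in> N" for N r x
    using assms that by (auto simp: subsemimodules_def)
  ultimately show ?thesis
    unfolding subsemimodules_def by auto
qed

text \<open>
  Being a subsemimodule is part of the definition of every type except semiprimeness, where it
  follows because an intersection of subsemimodules is one.
\<close>

lemma (in semimodule) distinguished_class_subset_subsemimodules:
  assumes "Dis \<in> distinguished_classes R M"
  shows "Dis \<subseteq> subsemimodules R M"
proof -
  have prime: "N \<in> subsemimodules R M" if "prime_subsemimodule R M N" for N
    using that by (simp add: prime_subsemimodule_def proper_subsemimodule_def)
  have "N \<in> subsemimodules R M" if semiprime: "semiprime_subsemimodule R M N" for N
  proof -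
    from semiprime obtain \<F> where "\<F> \<subseteq> {P. prime_subsemimodule R M P}" "N = carrier M \<inter> \<Inter>\<F>"
      unfolding semiprime_subsemimodule_def by blast
    moreover from this(1) have "\<F> \<subseteq> subsemimodules R M"
      using prime by blast
    ultimately show ?thesis
      using carrier_Int_Inter_subsemimodules by simp
  qed
  with prime assms show ?thesis
    unfolding distinguished_classes_def
    by (auto simp: subtractive_subsemimodule_def strong_subsemimodule_def
        proper_subsemimodule_def maximal_subsemimodule_def primary_subsemimodule_def
        weakly_prime_subsemimodule_def primal_subsemimodule_def extraordinary_subsemimodule_def
        strongly_irreducible_subsemimodule_def irreducible_subsemimodule_def
        completely_irreducible_subsemimodule_def cyclic_subsemimodule_def
        finitely_generated_subsemimodule_def minimal_subsemimodule_def
        minimal_prime_subsemimodule_def)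
qed

lemma (in semimodule) subsemimodules_above_eq_of_zero_mem:
  assumes "Dis \<subseteq> subsemimodules R M"
    and "N \<in> subsemimodules R M"
    and "{\<zero>\<^bsub>M\<^esub>} \<in> subsemimodules_above Dis N"
  shows "subsemimodules_above Dis N = Dis"
proof -
  have "N \<subseteq> {\<zero>\<^bsub>M\<^esub>}"
    using assms(3) by (simp add: subsemimodules_above_def)
  moreover have "\<zero>\<^bsub>M\<^esub> \<in> L" if "L \<in> Dis" for L
    using assms(1) that zero_mem_subsemimodule by blast
  ultimately show ?thesis
    by (auto simp: subsemimodules_above_def)
qed

text \<open>Stated for closed sets, this is the density of the point \<open>0\<close>.\<close>

lemma (in semimodule) closedin_subsemimodule_space_zero_mem:
  assumes "Dis \<subseteq> subsemimodules R M"
    and "closedin (subsemimodule_space R M Dis) C"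
    and "{\<zero>\<^bsub>M\<^esub>} \<in> C"
  shows "C = Dis"
proof -
  let ?V = "\<lambda>V. \<exists>N\<in>subsemimodules R M. V = subsemimodules_above Dis N"
  have "(arbitrary intersection_of (finite union_of ?V) relative_to Dis) C"
    using assms(2) by (simp only: closedin_subsemimodule_space)
  then obtain \<C> where \<C>: "\<C> \<subseteq> Collect (finite union_of ?V)" "C = Dis \<inter> \<Inter>\<C>"
    unfolding relative_to_def intersection_of_def by blast
  have "Dis \<subseteq> D" if D: "D \<in> \<C>" for D
  proof -
    have "(finite union_of ?V) D"
      using \<C>(1) D by blast
    then obtain \<T> where \<T>: "\<T> \<subseteq> Collect ?V" "\<Union>\<T> = D"
      unfolding union_of_def by blast
    have "{\<zero>\<^bsub>M\<^esub>} \<in> D"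
      using assms(3) \<C>(2) D by blast
    with \<T>(2) obtain T where T: "T \<in> \<T>" "{\<zero>\<^bsub>M\<^esub>} \<in> T"
      by blast
    then obtain N where "N \<in> subsemimodules R M" "T = subsemimodules_above Dis N"
      using \<T>(1) by blast
    then have "T = Dis"
      using subsemimodules_above_eq_of_zero_mem assms(1) T(2) by simp
    then show ?thesis
      using T(1) \<T>(2) by blast
  qed
  then show ?thesis
    using \<C>(2) by blast
qed

theorem theorem3p17:
  fixes R :: "('r, 'a) ring_scheme" and M :: "('r, 'm, 'b) module_scheme"
    and Dis :: "'m set set"
  assumes "semimodule R M"
    and "Dis \<in> distinguished_classes R M"
    and "{\<zero>\<^bsub>M\<^esub>} \<in> Dis"
  shows "connected_space (subsemimodule_space R M Dis)"
proof -
  interpret semimodule R M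
    by (fact assms(1))
  let ?X = "subsemimodule_space R M Dis"
  have "{\<zero>\<^bsub>M\<^esub>} \<in> ?X closure_of {{\<zero>\<^bsub>M\<^esub>}}"
    using assms(3) closure_of_subset[of "{{\<zero>\<^bsub>M\<^esub>}}" ?X] by simp
  then have dense: "?X closure_of {{\<zero>\<^bsub>M\<^esub>}} = Dis"
    using distinguished_class_subset_subsemimodules[OF assms(2)]
    by (intro closedin_subsemimodule_space_zero_mem closedin_closure_of)
  have "connectedin ?X {{\<zero>\<^bsub>M\<^esub>}}"
    using assms(3) by simp
  then have "connectedin ?X (?X closure_of {{\<zero>\<^bsub>M\<^esub>}})"
    by (rule connectedin_closure_of)
  then show ?thesis
    using dense by (simp add: connectedin_def subtopology_superset)
qed

end
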